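(* Let $p$ be a prime and, for $n\geq 1$, let $\varphi_n:=\varphi\bigl(v_1^{-\frac{p^n-1}{p-1}}t_n\bigr)\in KU_0ku_{(p)}\subset\mathbb{Q}[w]$. Then the semistable numerical polynomials $\varphi_n$ are given recursively by $$\varphi_1=\frac{w^{p-1}-1}{p}$$ and, for $n\ge 2$, $$\varphi_n=\frac{w^{p^n-1}-p^{n-1}\varphi_{n-1}^{p}-p^{n-2}\varphi_{n-2}^{p^2}-\cdots-p\,\varphi_1^{p^{n-1}}-1}{p^n}=\frac{w^{p^n-1}-1-\sum_{j=1}^{n-1}p^{\,n-j}\varphi_{n-j}^{\,p^j}}{p^n}.$$
   Context: $KU$ is complex $K$-theory and $ku$ its connective cover. Rationally $\pi_*(KU\wedge ku)\otimes\mathbb{Q}=\mathbb{Q}[v^{\pm1},u]$, where $v$ is the Bott element of the left factor $KU$ and $u$ that of the right factor $ku$; set $w:=u/v$. The map $KU_0ku_{(p)}\to KU_0ku\otimes\mathbb{Q}=\mathbb{Q}[w]$ is injective, and its elements, viewed as polynomials in $w$, are called ($p$-local) semistable numerical polynomials. $BP$ is the Brown–Peterson spectrum at $p$, with $BP_*=\mathbb{Z}_{(p)}[v_1,v_2,\ldots]$ ($v_i$ the Hazewinkel generators) and $BP_*BP=BP_*[t_1,t_2,\ldots]$ with the standard $t_i$ and right unit $\eta_R$. The Hazewinkel generators are determined by $p\lambda_n=\sum_{0\le i<n}\lambda_iv_{n-i}^{p^i}$ with $\lambda_0=1$, where $\lambda_n\in BP_*\otimes\mathbb{Q}$ is the coefficient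 of $x^{p^n}$ in the logarithm of the universal $p$-typical formal group law; and $\eta_R(\lambda_n)=\sum_{0\le i\le n}\lambda_it_{n-i}^{p^i}$ with $t_0=1$. $E(1)$ is the Johnson–Wilson theory, $\pi_*E(1)=\mathbb{Z}_{(p)}[v_1^{\pm1}]$, and $BP\langle1\rangle$ is the truncated Brown–Peterson spectrum, $\pi_*BP\langle1\rangle=\mathbb{Z}_{(p)}[v_1]$. One has $E(1)_*BP\langle1\rangle\cong E(1)_*\otimes_{BP_*}BP_*BP\otimes_{BP_*}BP\langle1\rangle_*\cong E(1)_*[t_1,t_2,\ldots]/(\eta_R(v_2),\eta_R(v_3),\ldots)$, and $\pi_*(E(1)\wedge BP\langle1\rangle)\otimes\mathbb{Q}=\mathbb{Q}[v_1^{\pm1},u_1]$, where $u_1=\eta_R(v_1)$. The map $\varphi:E(1)_*BP\langle1\rangle\to KU_*ku_{(p)}$ is induced by the inclusions of $E(1)$ and $BP\langle1\rangle$ as summands of $KU_{(p)}$ and $ku_{(p)}$ in the Adams splitting (equivalences when $p=2$). Rationally it is the ring map $v_1\mapsto v^{p-1}$, $u_1\mapsto u^{p-1}$. *)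

theory Defs
  imports
    "HOL-Algebra.QuotRing"
    "HOL-Library.Poly_Mapping"
    "HOL-Computational_Algebra.Polynomial"
    "HOL-Computational_Algebra.Primes"
begin

text \<open>
  The spectra enter only through their coefficient and cooperation rings. Rationally:
  \<^item> \<open>BP\<^sub>* \<otimes> \<rat> = \<rat>[v\<^sub>1, v\<^sub>2, \<dots>]\<close> is \<^typ>\<open>(nat \<Rightarrow>\<^sub>0 nat) \<Rightarrow>\<^sub>0 rat\<close>;
  \<^item> \<open>BP\<^sub>*BP \<otimes> \<rat>\<close> is the polynomial ring in \<open>t\<^sub>1, t\<^sub>2, \<dots>\<close> over \<open>BP\<^sub>* \<otimes> \<rat>\<close>;
  \<^item> \<open>E(1)\<^sub>* \<otimes> \<rat> = \<rat>[v\<^sub>1, v\<^sub>1\<^sup>-\<^sup>1]\<close> is the group ring \<^typ>\<open>int \<Rightarrow>\<^sub>0 rat\<close>;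
  \<^item> \<open>KU\<^sub>*ku \<otimes> \<rat> = \<rat>[v, v\<^sup>-\<^sup>1, u]\<close> is the ring of polynomials in \<open>u\<close> over \<^typ>\<open>int \<Rightarrow>\<^sub>0 rat\<close>.
  The integral (that is, \<open>p\<close>-local) rings are given by their carriers inside these types.
\<close>

type_synonym BP_rat = "(nat \<Rightarrow>\<^sub>0 nat) \<Rightarrow>\<^sub>0 rat"
type_synonym BPBP_rat = "(nat \<Rightarrow>\<^sub>0 nat) \<Rightarrow>\<^sub>0 BP_rat"
type_synonym laurent_rat = "int \<Rightarrow>\<^sub>0 rat"
type_synonym E1t_rat = "(nat \<Rightarrow>\<^sub>0 nat) \<Rightarrow>\<^sub>0 laurent_rat"
type_synonym KUku_rat = "laurent_rat poly"

definition subring_of_type :: "'a::comm_ring_1 set \<Rightarrow> 'a ring" where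
  "subring_of_type S = \<lparr>carrier = S, monoid.mult = (*), one = 1, zero = 0, add = (+)\<rparr>"

definition Z_loc :: "nat \<Rightarrow> rat set" where
  "Z_loc p = {of_int a / of_int b | a b. \<not> int p dvd b}"

definition coeffs_in :: "'c set \<Rightarrow> ('m \<Rightarrow>\<^sub>0 'c::zero) set" where
  "coeffs_in R = {x. range (Poly_Mapping.lookup x) \<subseteq> R}"

definition const :: "'c \<Rightarrow> ('m::zero \<Rightarrow>\<^sub>0 'c::zero)" where
  "const c = Poly_Mapping.single 0 c"

text \<open>
  The generators \<open>v\<^sub>n\<close> and \<open>t\<^sub>n\<close> are numbered from 1, the variables of the polynomial ring from 0.
  Index 0 is given the value 1, in accordance with the convention \<open>t\<^sub>0 = 1\<close>.
\<close>

definition gen :: "nat \<Rightarrow> ((nat \<Rightarrow>\<^sub>0 nat) \<Rightarrow>\<^sub>0 'c::zero_neq_one)" where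
  "gen n = Poly_Mapping.single (if n = 0 then 0 else Poly_Mapping.single (n - 1) 1) 1"

definition BP :: "nat \<Rightarrow> BP_rat set" where
  "BP p = coeffs_in (Z_loc p)"

definition BPBP :: "nat \<Rightarrow> BPBP_rat set" where
  "BPBP p = coeffs_in (BP p)"

text \<open>
  Logarithm coefficients in terms of the Hazewinkel generators:
  \<open>p \<lambda>\<^sub>n = \<Sum>\<^sub>0\<^sub>\<le>\<^sub>i\<^sub><\<^sub>n \<lambda>\<^sub>i v\<^sub>n\<^sub>-\<^sub>i\<^bsup>p^i\<^esup>\<close> and \<open>\<lambda>\<^sub>0 = 1\<close>.
\<close>

function log_coeff :: "nat \<Rightarrow> nat \<Rightarrow> BP_rat" where
  "log_coeff p n =
    (if n = 0 then 1
     else const (1 / of_nat p) * (\<Sum>i\<in>{0..<n}. log_coeff p i * gen (n - i) ^ (p ^ i)))"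
  by pat_completeness auto
termination by (relation "measure snd") auto

declare log_coeff.simps [simp del]

definition right_unit :: "nat \<Rightarrow> (BP_rat \<Rightarrow> BPBP_rat) \<Rightarrow> bool" where
  "right_unit p eta \<longleftrightarrow>
     eta \<in> ring_hom (subring_of_type UNIV) (subring_of_type UNIV) \<and>
     eta \<in> ring_hom (subring_of_type (BP p)) (subring_of_type (BPBP p)) \<and>
     (\<forall>n. eta (log_coeff p n) = (\<Sum>i\<in>{0..n}. const (log_coeff p i) * gen (n - i) ^ (p ^ i)))"

text \<open>
  The map \<open>BP\<^sub>* \<rightarrow> E(1)\<^sub>*\<close> sends \<open>v\<^sub>1\<close> to \<open>v\<^sub>1\<close> and \<open>v\<^sub>i\<close> to 0 for \<open>i \<ge> 2\<close>: only the coefficients of the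
  pure powers of \<open>v\<^sub>1\<close>, the variable with index 0, survive.
\<close>

definition BP_to_E1 :: "BP_rat \<Rightarrow> laurent_rat" where
  "BP_to_E1 x = (\<Sum>m \<in> {m \<in> Poly_Mapping.keys x. Poly_Mapping.keys m \<subseteq> {0}}.
     Poly_Mapping.single (int (Poly_Mapping.lookup m 0)) (Poly_Mapping.lookup x m))"

definition BPBP_to_E1t :: "BPBP_rat \<Rightarrow> E1t_rat" where
  "BPBP_to_E1t = Poly_Mapping.map BP_to_E1"

definition E1t :: "nat \<Rightarrow> E1t_rat ring" where
  "E1t p = subring_of_type (coeffs_in (coeffs_in (Z_loc p)))"

text \<open>\<open>E(1)\<^sub>*BP\<langle>1\<rangle> = E(1)\<^sub>*[t\<^sub>1, t\<^sub>2, \<dots>] / (\<eta>\<^sub>R(v\<^sub>2), \<eta>\<^sub>R(v\<^sub>3), \<dots>)\<close>\<close>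

definition E1BP1_ideal :: "nat \<Rightarrow> (BP_rat \<Rightarrow> BPBP_rat) \<Rightarrow> E1t_rat set" where
  "E1BP1_ideal p eta = Idl\<^bsub>E1t p\<^esub> {BPBP_to_E1t (eta (gen n)) | n. n \<ge> 2}"

definition E1BP1 :: "nat \<Rightarrow> (BP_rat \<Rightarrow> BPBP_rat) \<Rightarrow> E1t_rat set ring" where
  "E1BP1 p eta = E1t p Quot E1BP1_ideal p eta"

definition E1BP1_class :: "nat \<Rightarrow> (BP_rat \<Rightarrow> BPBP_rat) \<Rightarrow> E1t_rat \<Rightarrow> E1t_rat set" where
  "E1BP1_class p eta x = E1BP1_ideal p eta +>\<^bsub>E1t p\<^esub> x"

definition v1_pow :: "int \<Rightarrow> E1t_rat" where
  "v1_pow k = const (Poly_Mapping.single k 1)"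

definition v_pow :: "int \<Rightarrow> KUku_rat" where
  "v_pow k = [:Poly_Mapping.single k 1:]"

definition u_pow :: "nat \<Rightarrow> KUku_rat" where
  "u_pow k = monom 1 k"

text \<open>
  The map \<open>\<phi>\<close>, composed with the injection of \<open>KU\<^sub>*ku\<^sub>(\<^sub>p\<^sub>)\<close> into its rationalization. Since
  \<open>E(1)\<^sub>*BP\<langle>1\<rangle> \<otimes> \<rat> = \<rat>[v\<^sub>1, v\<^sub>1\<^sup>-\<^sup>1, u\<^sub>1]\<close> with \<open>u\<^sub>1 = \<eta>\<^sub>R(v\<^sub>1)\<close>, it is determined by the images of
  \<open>v\<^sub>1\<close> and \<open>u\<^sub>1\<close>.
\<close>

definition splitting_map ::
    "nat \<Rightarrow> (BP_rat \<Rightarrow> BPBP_rat) \<Rightarrow> (E1t_rat set \<Rightarrow> KUku_rat) \<Rightarrow> bool" where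
  "splitting_map p eta phi \<longleftrightarrow>
     phi \<in> ring_hom (E1BP1 p eta) (subring_of_type UNIV) \<and>
     phi (E1BP1_class p eta (v1_pow 1)) = v_pow (int (p - 1)) \<and>
     phi (E1BP1_class p eta (BPBP_to_E1t (eta (gen 1)))) = u_pow (p - 1)"

text \<open>
  By the Adams splitting, \<open>KU\<^sub>(\<^sub>p\<^sub>)\<close> is the sum of the \<open>v\<^sup>i E(1)\<close> and \<open>ku\<^sub>(\<^sub>p\<^sub>)\<close> the sum of the
  \<open>u\<^sup>j BP\<langle>1\<rangle>\<close> over \<open>0 \<le> i, j < p - 1\<close>. Hence, as a subgroup of its rationalization, \<open>KU\<^sub>*ku\<^sub>(\<^sub>p\<^sub>)\<close> is
  the sum of the \<open>v\<^sup>i u\<^sup>j \<phi>(E(1)\<^sub>*BP\<langle>1\<rangle>)\<close>.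
\<close>

definition KUku ::
    "nat \<Rightarrow> (BP_rat \<Rightarrow> BPBP_rat) \<Rightarrow> (E1t_rat set \<Rightarrow> KUku_rat) \<Rightarrow> KUku_rat set" where
  "KUku p eta phi =
     {(\<Sum>i<p - 1. \<Sum>j<p - 1. v_pow (int i) * u_pow j * phi (x i j)) | x.
        \<forall>i j. x i j \<in> carrier (E1BP1 p eta)}"

text \<open>The inclusion of \<open>\<rat>[w]\<close> into \<open>\<rat>[v, v\<^sup>-\<^sup>1, u]\<close>, substituting \<open>w = u / v\<close>.\<close>

definition subst_w :: "rat poly \<Rightarrow> KUku_rat" where
  "subst_w f = pcompose (map_poly const f) (v_pow (- 1) * u_pow 1)"

definition semistable_numerical ::
    "nat \<Rightarrow> (BP_rat \<Rightarrow> BPBP_rat) \<Rightarrow> (E1t_rat set \<Rightarrow> KUku_rat) \<Rightarrow> rat poly set" where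
  "semistable_numerical p eta phi = {f. subst_w f \<in> KUku p eta phi}"

definition normalized_t :: "nat \<Rightarrow> (BP_rat \<Rightarrow> BPBP_rat) \<Rightarrow> nat \<Rightarrow> E1t_rat set" where
  "normalized_t p eta n =
     E1BP1_class p eta (v1_pow (- int ((p ^ n - 1) div (p - 1))) * gen n)"

definition phi_poly ::
    "nat \<Rightarrow> (BP_rat \<Rightarrow> BPBP_rat) \<Rightarrow> (E1t_rat set \<Rightarrow> KUku_rat) \<Rightarrow> nat \<Rightarrow> rat poly" where
  "phi_poly p eta phi n = (THE f. subst_w f = phi (normalized_t p eta n))"

abbreviation w :: "rat poly" where
  "w \<equiv> monom 1 1"

end

theory Submission
  imports Defs
begin

text \<open>
  Both units \<open>BP\<^sub>* \<rightarrow> BP\<^sub>*BP \<rightarrow> KU\<^sub>*ku \<otimes> \<rat>\<close> kill \<open>v\<^sub>n\<close> for \<open>n \<ge> 2\<close>: the left one because \<open>E(1)\<close> has no such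
  generators, the right one because \<open>\<eta>\<^sub>R(v\<^sub>n)\<close> lies in the ideal of relations. Once all \<open>v\<^sub>n\<close> with
  \<open>n \<ge> 2\<close> are zero, the Hazewinkel recursion \<open>p \<lambda>\<^sub>n = \<lambda>\<^sub>n\<^sub>-\<^sub>1 v\<^sub>1\<^bsup>p^(n-1)\<^esup>\<close> has the solution
  \<open>p\<^sup>n \<lambda>\<^sub>n = v\<^sub>1\<^bsup>(p^n-1)/(p-1)\<^esup>\<close>. Since \<open>v\<^sub>1\<close> goes to \<open>v\<^bsup>p-1\<^esup>\<close> on the left and to \<open>u\<^bsup>p-1\<^esup>\<close> on the right,
  \<open>p\<^sup>n \<lambda>\<^sub>n\<close> goes to \<open>v\<^bsup>p^n-1\<^esup>\<close> and \<open>u\<^bsup>p^n-1\<^esup>\<close> respectively (\<open>hom_int_log\<close>). The right unit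
  formula for \<open>\<lambda>\<^sub>n\<close>, multiplied by \<open>p\<^sup>n\<close>, therefore becomes (\<open>realization_int_log_relation\<close>)
  \<open>u\<^bsup>p^n-1\<^esup> = \<Sum>\<^sub>i\<^sub>\<le>\<^sub>n p\<^bsup>n-i\<^esup> v\<^bsup>p^i-1\<^esup> t\<^sub>n\<^sub>-\<^sub>i\<^bsup>p^i\<^esup>\<close>.
  Division by \<open>v\<^bsup>p^n-1\<^esup>\<close> turns it into
  \<open>w\<^bsup>p^n-1\<^esup> = \<Sum>\<^sub>i\<^sub>\<le>\<^sub>n p\<^bsup>n-i\<^esup> \<phi>\<^sub>n\<^sub>-\<^sub>i\<^bsup>p^i\<^esup>\<close>, where the powers of \<open>v\<close> are exactly those in the
  normalization of the \<open>t\<^sub>k\<close> (\<open>normalized_t_relation\<close>). The term \<open>i = n\<close> is 1 and the term \<open>i = 0\<close> is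
  \<open>p\<^sup>n \<phi>\<^sub>n\<close>; solving for the latter is the recursion.

  Two points need care. The map \<open>\<phi>\<close> is defined on a quotient of a \<open>p\<close>-local ring only, where
  \<open>\<lambda>\<^sub>n\<close> is not available; this is why the elements \<open>p\<^sup>n \<lambda>\<^sub>n\<close>, which are polynomials in the \<open>v\<^sub>i\<close> with
  integer coefficients, take its place. And that the image of the normalized \<open>t\<^sub>n\<close> is a polynomial in
  \<open>w\<close> at all is a consequence of the recursion, by induction on \<open>n\<close>; it is a unique one since the
  substitution of \<open>u / v\<close> for \<open>w\<close> is injective (\<open>subst_w_inject\<close>).
\<close>

section \<open>Subrings of commutative rings given by types\<close>

lemma cring_subring_of_typeI:
  fixes S :: "'a::comm_ring_1 set"
  assumes "0 \<in> S" "1 \<in> S"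
    and "\<And>x y. x \<in> S \<Longrightarrow> y \<in> S \<Longrightarrow> x + y \<in> S"
    and "\<And>x y. x \<in> S \<Longrightarrow> y \<in> S \<Longrightarrow> x * y \<in> S"
    and "\<And>x. x \<in> S \<Longrightarrow> - x \<in> S"
  shows "cring (subring_of_type S)"
proof (intro cringI abelian_groupI comm_monoidI)
  fix x assume "x \<in> carrier (subring_of_type S)"
  with assms(5) show "\<exists>y\<in>carrier (subring_of_type S).
      y \<oplus>\<^bsub>subring_of_type S\<^esub> x = \<zero>\<^bsub>subring_of_type S\<^esub>"
    by (intro bexI[of _ "- x"]) (simp_all add: subring_of_type_def)
qed (use assms in \<open>simp_all add: subring_of_type_def algebra_simps\<close>)

lemma cring_subring_of_type_UNIV: "cring (subring_of_type UNIV)"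
  by (rule cring_subring_of_typeI) auto

text \<open>
  Integrality enters through homomorphisms that respect the ring operations on a subset \<open>S\<close> of a type
  only. The facts below phrase closure of such a subset, and compatibility of such a map, in the
  notation of the type class, so that the operations of the ring record can be avoided afterwards.
\<close>

context
  fixes S :: "'a::comm_ring_1 set"
  assumes S: "cring (subring_of_type S)"
begin

interpretation cring "subring_of_type S" by (rule S)

lemma subring_zero: "0 \<in> S" and subring_one: "1 \<in> S"
  using zero_closed one_closed by (simp_all add: subring_of_type_def)

lemma subring_add: "x \<in> S \<Longrightarrow> y \<in> S \<Longrightarrow> x + y \<in> S"
  and subring_mult: "x \<in> S \<Longrightarrow> y \<in> S \<Longrightarrow> x * y \<in> S"
  using a_closed[of x y] m_closed[of x y] by (simp_all add: subring_of_type_def)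

lemma subring_uminus:
  assumes "x \<in> S"
  shows "- x \<in> S"
proof -
  let ?y = "\<ominus>\<^bsub>subring_of_type S\<^esub> x"
  have "?y \<in> S" "?y + x = 0"
    using a_inv_closed[of x] l_neg[of x] assms by (simp_all add: subring_of_type_def)
  then show ?thesis by (metis eq_neg_iff_add_eq_0)
qed

lemma subring_sum: "(\<And>i. i \<in> A \<Longrightarrow> f i \<in> S) \<Longrightarrow> sum f A \<in> S"
  by (induction A rule: infinite_finite_induct) (auto intro: subring_zero subring_add)

lemma subring_power: "x \<in> S \<Longrightarrow> x ^ n \<in> S"
  by (induction n) (auto intro: subring_one subring_mult)

lemma subring_of_nat: "of_nat n \<in> S"
  by (induction n) (auto intro: subring_one subring_zero subring_add)

lemma subring_Sum_any: "(\<And>i. f i \<in> S) \<Longrightarrow> Sum_any f \<in> S"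
  by (simp add: Sum_any.expand_set subring_sum)

lemma cring_coeffs_in:
  "cring (subring_of_type (coeffs_in S :: ('m::comm_monoid_add \<Rightarrow>\<^sub>0 'a) set))"
proof (rule cring_subring_of_typeI)
  have when_in: "(a when Q) \<in> S" if "a \<in> S" for a Q
    using that by (simp add: when_def subring_zero)
  fix x y :: "'m \<Rightarrow>\<^sub>0 'a"
  assume "x \<in> coeffs_in S" "y \<in> coeffs_in S"
  then show "x * y \<in> coeffs_in S"
    by (auto simp: coeffs_in_def lookup_mult image_subset_iff
        intro!: subring_Sum_any subring_mult when_in)
qed (auto simp: coeffs_in_def lookup_add lookup_one when_def image_subset_iff
    intro: subring_zero subring_one subring_add subring_uminus)

lemma single_in_coeffs_in: "c \<in> S \<Longrightarrow> Poly_Mapping.single m c \<in> coeffs_in S"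
  by (auto simp: coeffs_in_def lookup_single when_def subring_zero)

lemma gen_in_coeffs_in: "gen n \<in> coeffs_in S"
  unfolding gen_def by (intro single_in_coeffs_in subring_one)

context
  fixes h :: "'a \<Rightarrow> 'b::comm_ring_1" and T
  assumes h: "h \<in> ring_hom (subring_of_type S) (subring_of_type T)"
begin

lemma hom_mult: "x \<in> S \<Longrightarrow> y \<in> S \<Longrightarrow> h (x * y) = h x * h y"
  and hom_add: "x \<in> S \<Longrightarrow> y \<in> S \<Longrightarrow> h (x + y) = h x + h y"
  and hom_one: "h 1 = 1"
  using ring_hom_memE[OF h] by (simp_all add: subring_of_type_def)

lemma hom_zero: "h 0 = 0"
  using hom_add[of 0 0] subring_zero by simp

lemma hom_sum: "(\<And>i. i \<in> A \<Longrightarrow> f i \<in> S) \<Longrightarrow> h (sum f A) = (\<Sum>i\<in>A. h (f i))"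
  by (induction A rule: infinite_finite_induct) (auto simp: hom_zero hom_add subring_sum)

lemma hom_power: "x \<in> S \<Longrightarrow> h (x ^ n) = h x ^ n"
  by (induction n) (auto simp: hom_one hom_mult subring_power)

lemma hom_of_nat: "h (of_nat n) = of_nat n"
  by (induction n) (auto simp: hom_zero hom_one hom_add subring_of_nat subring_one)

end

end

lemma cring_Z_loc:
  assumes "prime p"
  shows "cring (subring_of_type (Z_loc p))"
proof (rule cring_subring_of_typeI)
  note not_dvd_mult = prime_dvd_mult_iff[OF prime_nat_int_transfer[THEN iffD2, OF assms]]
  have p1: "\<not> int p dvd 1"
    using assms not_prime_unit by auto
  show "0 \<in> Z_loc p"
    unfolding Z_loc_def using p1 by (intro CollectI exI[of _ 0] exI[of _ 1]) simp
  show "1 \<in> Z_loc p"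
    unfolding Z_loc_def using p1 by (intro CollectI exI[of _ 1]) simp
  fix x y assume "x \<in> Z_loc p" "y \<in> Z_loc p"
  then obtain a b c d where x: "x = of_int a / of_int b" "\<not> int p dvd b"
    and y: "y = of_int c / of_int d" "\<not> int p dvd d"
    unfolding Z_loc_def by blast
  then have "b \<noteq> 0" "d \<noteq> 0" by auto
  then show "x + y \<in> Z_loc p" "x * y \<in> Z_loc p"
    unfolding Z_loc_def using x y not_dvd_mult
    by (intro CollectI exI[of _ "a * d + c * b"] exI[of _ "a * c"] exI[of _ "b * d"];
        simp add: field_simps)+
next
  fix x assume "x \<in> Z_loc p"
  then obtain a b where "x = of_int a / of_int b" "\<not> int p dvd b"
    unfolding Z_loc_def by blast
  then show "- x \<in> Z_loc p"
    unfolding Z_loc_def by (intro CollectI exI[of _ "- a"] exI[of _ b]) simp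
qed

section \<open>Reduction from BP to E(1)\<close>

lemma sum_monomials: "x = (\<Sum>m\<in>Poly_Mapping.keys x. Poly_Mapping.single m (Poly_Mapping.lookup x m))"
proof (rule poly_mapping_eqI)
  fix k
  have "(\<Sum>m\<in>Poly_Mapping.keys x. Poly_Mapping.lookup x m when m = k) = Poly_Mapping.lookup x k"
    by (simp add: when_def sum.delta' in_keys_iff)
  then show "Poly_Mapping.lookup x k = Poly_Mapping.lookup
      (\<Sum>m\<in>Poly_Mapping.keys x. Poly_Mapping.single m (Poly_Mapping.lookup x m)) k"
    by (simp add: lookup_sum lookup_single)
qed

text \<open>
  Both arguments are sums of monomials, so biadditivity reduces multiplicativity to monomials.
\<close>

lemma additive_mult_if_on_monomials:
  fixes F :: "('m::monoid_add \<Rightarrow>\<^sub>0 'a::semiring_0) \<Rightarrow> 'b::ring"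
  assumes add: "\<And>x y. F (x + y) = F x + F y"
    and single: "\<And>m n a b. F (Poly_Mapping.single m a * Poly_Mapping.single n b) =
      F (Poly_Mapping.single m a) * F (Poly_Mapping.single n b)"
  shows "F (x * y) = F x * F y"
proof -
  have F0: "F 0 = 0" using add[of 0 0] by simp
  have sum: "F (sum f A) = (\<Sum>i\<in>A. F (f i))" for f :: "'m \<Rightarrow> _" and A
    by (induction A rule: infinite_finite_induct) (auto simp: F0 add)
  let ?X = "\<lambda>m. Poly_Mapping.single m (Poly_Mapping.lookup x m)"
  let ?Y = "\<lambda>m. Poly_Mapping.single m (Poly_Mapping.lookup y m)"
  have "F (x * y) = F ((\<Sum>m\<in>Poly_Mapping.keys x. ?X m) * (\<Sum>n\<in>Poly_Mapping.keys y. ?Y n))"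
    by (simp flip: sum_monomials)
  also have "\<dots> = F (\<Sum>m\<in>Poly_Mapping.keys x. ?X m) * F (\<Sum>n\<in>Poly_Mapping.keys y. ?Y n)"
    by (simp only: sum_product sum single)
  finally show ?thesis by (simp flip: sum_monomials)
qed

text \<open>
  Coefficientwise, the reduction reads off the coefficients of the powers of \<open>v\<^sub>1\<close>. In this form its
  additivity and its compatibility with \<open>p\<close>-local coefficients are immediate.
\<close>

lemma lookup_BP_to_E1:
  "Poly_Mapping.lookup (BP_to_E1 x) k =
    (if k \<ge> 0 then Poly_Mapping.lookup x (Poly_Mapping.single 0 (nat k)) else 0)"
proof -
  let ?A = "{m \<in> Poly_Mapping.keys x. Poly_Mapping.keys m \<subseteq> {0}}"
  have pure: "int (Poly_Mapping.lookup m 0) = k \<longleftrightarrow> k \<ge> 0 \<and> m = Poly_Mapping.single 0 (nat k)"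
    if "m \<in> ?A" for m
  proof -
    have "m = Poly_Mapping.single 0 (Poly_Mapping.lookup m 0)"
      using that by (intro poly_mapping_eqI) (auto simp: lookup_single when_def in_keys_iff)
    then show ?thesis by (metis lookup_single_eq nat_int int_nat_eq of_nat_0_le_iff)
  qed
  have "Poly_Mapping.lookup (BP_to_E1 x) k =
      (\<Sum>m\<in>?A. Poly_Mapping.lookup x m when int (Poly_Mapping.lookup m 0) = k)"
    by (simp add: BP_to_E1_def lookup_sum lookup_single)
  also have "\<dots> = (\<Sum>m\<in>?A. if m = Poly_Mapping.single 0 (nat k) then
      (if k \<ge> 0 then Poly_Mapping.lookup x m else 0) else 0)"
    by (rule sum.cong) (auto simp: pure when_def)
  also have "\<dots> = (if k \<ge> 0 then Poly_Mapping.lookup x (Poly_Mapping.single 0 (nat k)) else 0)"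
    by (auto simp: sum.delta in_keys_iff)
  finally show ?thesis .
qed

lemma BP_to_E1_single:
  "BP_to_E1 (Poly_Mapping.single m a) =
    (if Poly_Mapping.keys m \<subseteq> {0} then Poly_Mapping.single (int (Poly_Mapping.lookup m 0)) a else 0)"
proof -
  have "{k. k = m \<and> Poly_Mapping.keys k \<subseteq> {0}} = (if Poly_Mapping.keys m \<subseteq> {0} then {m} else {})"
    by auto
  then show ?thesis by (simp add: BP_to_E1_def)
qed

lemma BP_to_E1_add: "BP_to_E1 (x + y) = BP_to_E1 x + BP_to_E1 y"
  by (rule poly_mapping_eqI) (simp add: lookup_BP_to_E1 lookup_add)

lemma keys_add_nat: "Poly_Mapping.keys (m + n) = Poly_Mapping.keys m \<union> Poly_Mapping.keys n"
  for m n :: "'i \<Rightarrow>\<^sub>0 nat"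
  by (auto simp: in_keys_iff lookup_add)

text \<open>
  A product of two monomials is a pure power of \<open>v\<^sub>1\<close> if and only if both factors are: exponents are
  natural numbers, hence the support of a product of monomials is the union of the supports.
\<close>

lemma BP_to_E1_mult: "BP_to_E1 (x * y) = BP_to_E1 x * BP_to_E1 y"
  by (rule additive_mult_if_on_monomials)
    (auto simp: BP_to_E1_add BP_to_E1_single mult_single keys_add_nat lookup_add)

lemma BP_to_E1_zero: "BP_to_E1 0 = 0"
  by (simp add: BP_to_E1_def)

lemma BP_to_E1_one: "BP_to_E1 1 = 1"
  using BP_to_E1_single[of 0 1] by simp

lemma lookup_BPBP_to_E1t:
  "Poly_Mapping.lookup (BPBP_to_E1t x) m = BP_to_E1 (Poly_Mapping.lookup x m)"
  by (simp add: BPBP_to_E1t_def map.rep_eq when_def BP_to_E1_zero)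

lemma BPBP_to_E1t_single:
  "BPBP_to_E1t (Poly_Mapping.single m a) = Poly_Mapping.single m (BP_to_E1 a)"
  by (rule poly_mapping_eqI) (simp add: lookup_BPBP_to_E1t lookup_single when_def BP_to_E1_zero)

lemma BPBP_to_E1t_add: "BPBP_to_E1t (x + y) = BPBP_to_E1t x + BPBP_to_E1t y"
  by (rule poly_mapping_eqI) (simp add: lookup_BPBP_to_E1t lookup_add BP_to_E1_add)

lemma BPBP_to_E1t_mult: "BPBP_to_E1t (x * y) = BPBP_to_E1t x * BPBP_to_E1t y"
  by (rule additive_mult_if_on_monomials)
    (simp_all add: BPBP_to_E1t_add BPBP_to_E1t_single mult_single BP_to_E1_mult)

lemma BPBP_to_E1t_gen: "BPBP_to_E1t (gen n) = gen n"
  by (simp add: gen_def BPBP_to_E1t_single BP_to_E1_one)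

lemma BPBP_to_E1t_const_gen:
  assumes "n \<ge> 1"
  shows "BPBP_to_E1t (const (gen n)) = (if n = 1 then v1_pow 1 else 0)"
  using assms by (auto simp: const_def gen_def BPBP_to_E1t_single BP_to_E1_single v1_pow_def)

lemma BPBP_to_E1t_hom:
  assumes "prime p"
  shows "BPBP_to_E1t \<in> ring_hom (subring_of_type (BPBP p)) (E1t p)"
proof (rule ring_hom_memI)
  fix x assume "x \<in> carrier (subring_of_type (BPBP p))"
  then show "BPBP_to_E1t x \<in> carrier (E1t p)"
    using subring_zero[OF cring_Z_loc[OF assms]]
    by (auto simp: subring_of_type_def BPBP_def BP_def E1t_def coeffs_in_def image_subset_iff
        lookup_BPBP_to_E1t lookup_BP_to_E1)
qed (use BPBP_to_E1t_gen[of 0] in \<open>simp_all add: subring_of_type_def E1t_def BPBP_to_E1t_add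
  BPBP_to_E1t_mult gen_def\<close>)

section \<open>Logarithm coefficients with cleared denominators\<close>

text \<open>
  The factor \<open>p\<^sup>n\<close> is the least power of \<open>p\<close> that makes \<open>\<lambda>\<^sub>n\<close> a polynomial with integer coefficients.
\<close>

definition int_log :: "nat \<Rightarrow> nat \<Rightarrow> BP_rat" where
  "int_log p n = of_nat p ^ n * log_coeff p n"

lemma int_log_0: "int_log p 0 = 1"
  by (simp add: int_log_def log_coeff.simps)

lemma int_log_rec:
  assumes "p > 0" "n > 0"
  shows "int_log p n = (\<Sum>i<n. of_nat p ^ (n - 1 - i) * int_log p i * gen (n - i) ^ (p ^ i))"
proof -
  have "of_nat p * const (1 / of_nat p) = (1 :: BP_rat)"
    using assms by (simp add: const_def mult_single flip: single_of_nat)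
  then have "of_nat p ^ n * const (1 / of_nat p) = (of_nat p ^ (n - 1) :: BP_rat)"
    using assms by (cases n) (simp_all add: mult.assoc mult.commute mult.left_commute)
  then have "int_log p n =
      of_nat p ^ (n - 1) * (\<Sum>i<n. log_coeff p i * gen (n - i) ^ (p ^ i))"
    using assms by (simp add: int_log_def log_coeff.simps[of p n] lessThan_atLeast0 flip: mult.assoc)
  also have "\<dots> = (\<Sum>i<n. of_nat p ^ (n - 1) * (log_coeff p i * gen (n - i) ^ (p ^ i)))"
    by (rule sum_distrib_left)
  also have "\<dots> = (\<Sum>i<n. of_nat p ^ (n - 1 - i) * int_log p i * gen (n - i) ^ (p ^ i))"
  proof (rule sum.cong)
    fix i assume "i \<in> {..<n}"
    then have "(of_nat p :: BP_rat) ^ (n - 1) = of_nat p ^ (n - 1 - i) * of_nat p ^ i"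
      by (simp flip: power_add)
    then show "of_nat p ^ (n - 1) * (log_coeff p i * gen (n - i) ^ (p ^ i)) =
        of_nat p ^ (n - 1 - i) * int_log p i * gen (n - i) ^ (p ^ i)"
      by (simp add: int_log_def mult_ac)
  qed simp
  finally show ?thesis .
qed

lemma cring_BP: "prime p \<Longrightarrow> cring (subring_of_type (BP p))"
  unfolding BP_def by (intro cring_coeffs_in cring_Z_loc)

lemma gen_in_BP: "prime p \<Longrightarrow> gen n \<in> BP p"
  unfolding BP_def by (intro gen_in_coeffs_in cring_Z_loc)

lemma int_log_in_BP:
  assumes "prime p"
  shows "int_log p n \<in> BP p"
proof (induction n rule: less_induct)
  case (less n)
  note BP = cring_BP[OF assms]
  show ?case
  proof (cases "n = 0")
    case True
    then show ?thesis by (simp add: int_log_0 subring_one[OF BP])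
  next
    case False
    then show ?thesis
      using less by (auto simp: int_log_rec prime_gt_0_nat[OF assms]
          intro!: subring_sum[OF BP] subring_mult[OF BP] subring_power[OF BP] subring_of_nat[OF BP]
            gen_in_BP[OF assms])
  qed
qed

text \<open>
  In the recursion for \<open>p\<^sup>n \<lambda>\<^sub>n\<close> the only summand that survives under \<open>h\<close> is the one with \<open>v\<^sub>1\<close>, so the
  exponent of \<open>y\<close> grows from \<open>p\<^sup>n - 1\<close> by \<open>(p - 1) p\<^sup>n\<close> to \<open>p\<^sup>n\<^sup>+\<^sup>1 - 1\<close>. The lemma serves for both units,
  with \<open>y = v\<close> and \<open>y = u\<close>.
\<close>

lemma hom_int_log:
  fixes y :: "'b::comm_ring_1"
  assumes "prime p" and h: "h \<in> ring_hom (subring_of_type (BP p)) (subring_of_type T)"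
    and gen_1: "h (gen 1) = y ^ (p - 1)" and gen_0: "\<And>n. n \<ge> 2 \<Longrightarrow> h (gen n) = 0"
  shows "h (int_log p n) = y ^ (p ^ n - 1)"
proof (induction n)
  note BP = cring_BP[OF assms(1)]
  case 0
  then show ?case by (simp add: int_log_0 hom_one[OF BP h])
next
  note BP = cring_BP[OF assms(1)]
  note in_BP = int_log_in_BP[OF assms(1)] gen_in_BP[OF assms(1)] subring_power[OF BP]
    subring_of_nat[OF BP] subring_mult[OF BP]
  have p: "p > 0" by (rule prime_gt_0_nat[OF assms(1)])
  case (Suc n)
  have "h (int_log p (Suc n)) =
      (\<Sum>i<Suc n. of_nat p ^ (n - i) * h (int_log p i) * h (gen (Suc n - i)) ^ (p ^ i))"
    using p by (simp add: int_log_rec hom_sum[OF BP h] in_BP hom_mult[OF BP h]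
        hom_power[OF BP h] hom_of_nat[OF BP h] del: sum.lessThan_Suc)
  also have "\<dots> = h (int_log p n) * h (gen 1) ^ (p ^ n)"
  proof -
    have "(\<Sum>i<n. of_nat p ^ (n - i) * h (int_log p i) * h (gen (Suc n - i)) ^ (p ^ i)) = 0"
      using p by (intro sum.neutral) (auto simp: gen_0 zero_power)
    then show ?thesis by simp
  qed
  also have "\<dots> = y ^ ((p ^ n - 1) + (p - 1) * p ^ n)"
    by (simp add: Suc gen_1[simplified] power_add power_mult)
  also have "(p ^ n - 1) + (p - 1) * p ^ n = p ^ Suc n - 1"
    using p by (simp add: algebra_simps Nat.diff_mult_distrib)
  finally show ?case .
qed

lemma const_of_nat_mult: "const (of_nat k * x) = of_nat k * const x"
  for x :: "'c::semiring_1"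
proof -
  have "of_nat k * const x = Poly_Mapping.single 0 (of_nat k) * const x"
    by simp
  also have "\<dots> = const (of_nat k * x)"
    by (simp only: const_def mult_single add_0_left)
  finally show ?thesis ..
qed

text \<open>
  The factor \<open>p\<^sup>n\<close> splits as \<open>p\<^sup>n\<^sup>-\<^sup>i p\<^sup>i\<close>, and \<open>p\<^sup>i\<close> clears the denominator of \<open>\<lambda>\<^sub>i\<close>.
\<close>

lemma right_unit_int_log:
  assumes "prime p" "right_unit p eta"
  shows "eta (int_log p n) =
    (\<Sum>i\<le>n. of_nat p ^ (n - i) * const (int_log p i) * gen (n - i) ^ (p ^ i))"
proof -
  note eta = assms(2)[unfolded right_unit_def, THEN conjunct1]
  have "eta (int_log p n) = of_nat p ^ n *
      (\<Sum>i\<le>n. const (log_coeff p i) * gen (n - i) ^ (p ^ i))"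
    using assms(2)
    by (simp add: int_log_def hom_mult[OF cring_subring_of_type_UNIV eta]
        hom_power[OF cring_subring_of_type_UNIV eta] hom_of_nat[OF cring_subring_of_type_UNIV eta]
        right_unit_def atLeast0AtMost)
  also have "\<dots> = (\<Sum>i\<le>n. of_nat p ^ n * (const (log_coeff p i) * gen (n - i) ^ (p ^ i)))"
    by (rule sum_distrib_left)
  also have "\<dots> = (\<Sum>i\<le>n. of_nat p ^ (n - i) * const (int_log p i) * gen (n - i) ^ (p ^ i))"
  proof (rule sum.cong)
    fix i assume "i \<in> {..n}"
    then have "(of_nat p :: BPBP_rat) ^ n = of_nat p ^ (n - i) * of_nat p ^ i"
      by (simp flip: power_add)
    moreover have "const (int_log p i) = of_nat p ^ i * (const (log_coeff p i) :: BPBP_rat)"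
      by (simp add: int_log_def const_of_nat_mult flip: of_nat_power)
    ultimately show "of_nat p ^ n * (const (log_coeff p i) * gen (n - i) ^ (p ^ i)) =
        of_nat p ^ (n - i) * const (int_log p i) * gen (n - i) ^ (p ^ i)"
      by (simp add: mult_ac)
  qed simp
  finally show ?thesis .
qed

section \<open>Substitution of u / v for w\<close>

text \<open>
  Under \<open>w = u / v\<close> the coefficient of \<open>u\<^sup>i\<close> is a multiple of \<open>v\<^sup>-\<^sup>i\<close>. Hence the substitution can be
  inverted coefficient by coefficient.
\<close>

lemma coeff_subst_w: "coeff (subst_w f) i = Poly_Mapping.single (- int i) (coeff f i)"
proof -
  have W: "v_pow (- 1) * u_pow 1 = monom (Poly_Mapping.single (- 1) 1) (Suc 0)"
    by (simp add: v_pow_def u_pow_def smult_monom)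
  have "Poly_Mapping.single (- 1 :: int) (1 :: rat) ^ i = Poly_Mapping.single (- int i) 1"
    by (induction i) (simp_all add: mult_single)
  moreover have "coeff (map_poly const f :: KUku_rat) i = Poly_Mapping.single 0 (coeff f i)"
    unfolding const_def by (rule coeff_map_poly) simp
  ultimately show ?thesis
    by (simp only: subst_w_def W coeff_pcompose_monom_linear mult_single) simp
qed

lemma subst_w_inject: "subst_w f = subst_w g \<longleftrightarrow> f = g"
proof
  assume "subst_w f = subst_w g"
  then have "Poly_Mapping.single (- int i) (coeff f i) = Poly_Mapping.single (- int i) (coeff g i)" for i
    by (simp flip: coeff_subst_w)
  then show "f = g" by (metis lookup_single_eq poly_eqI)
qed simp

lemma subst_w_hom: "subst_w \<in> ring_hom (subring_of_type UNIV) (subring_of_type UNIV)"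
proof (rule ring_hom_memI)
  have single_sum: "Poly_Mapping.single k (sum f A) = (\<Sum>i\<in>A. Poly_Mapping.single k (f i))"
    for k :: int and f :: "nat \<Rightarrow> rat" and A
    by (induction A rule: infinite_finite_induct) (simp_all add: single_add)
  fix f g :: "rat poly"
  have "subst_w (f * g) = subst_w f * subst_w g"
    by (rule poly_eqI) (auto simp: coeff_subst_w coeff_mult single_sum mult_single intro!: sum.cong)
  then show "subst_w (f \<otimes>\<^bsub>subring_of_type UNIV\<^esub> g) =
      subst_w f \<otimes>\<^bsub>subring_of_type UNIV\<^esub> subst_w g"
    by (simp add: subring_of_type_def)
  have "subst_w (f + g) = subst_w f + subst_w g"
    by (rule poly_eqI) (simp add: coeff_subst_w single_add)
  then show "subst_w (f \<oplus>\<^bsub>subring_of_type UNIV\<^esub> g) =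
      subst_w f \<oplus>\<^bsub>subring_of_type UNIV\<^esub> subst_w g"
    by (simp add: subring_of_type_def)
next
  have "subst_w 1 = 1"
    by (rule poly_eqI) (simp add: coeff_subst_w)
  then show "subst_w \<one>\<^bsub>subring_of_type UNIV\<^esub> = \<one>\<^bsub>subring_of_type UNIV\<^esub>"
    by (simp add: subring_of_type_def)
qed (simp add: subring_of_type_def)

lemma subst_w_mult: "subst_w (f * g) = subst_w f * subst_w g"
  and subst_w_add: "subst_w (f + g) = subst_w f + subst_w g"
  and subst_w_one: "subst_w 1 = 1"
  and subst_w_sum: "subst_w (sum F A) = (\<Sum>i\<in>A. subst_w (F i))"
  and subst_w_power: "subst_w (f ^ n) = subst_w f ^ n"
  and subst_w_of_nat: "subst_w (of_nat n) = of_nat n"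
  using hom_mult[OF cring_subring_of_type_UNIV subst_w_hom]
    hom_add[OF cring_subring_of_type_UNIV subst_w_hom]
    hom_one[OF cring_subring_of_type_UNIV subst_w_hom]
    hom_sum[OF cring_subring_of_type_UNIV subst_w_hom]
    hom_power[OF cring_subring_of_type_UNIV subst_w_hom]
    hom_of_nat[OF cring_subring_of_type_UNIV subst_w_hom]
  by simp_all

lemma subst_w_diff: "subst_w (f - g) = subst_w f - subst_w g"
  using subst_w_add[of "f - g" g] by simp

lemma subst_w_w_power: "subst_w (w ^ n) = v_pow (- int n) * u_pow n"
  by (rule poly_eqI)
    (simp add: coeff_subst_w v_pow_def u_pow_def monom_power smult_monom when_def)

lemma v_pow_add: "v_pow (k + l) = v_pow k * v_pow l"
  by (simp add: v_pow_def mult_single mult.commute)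

lemma v_pow_power: "v_pow k ^ n = v_pow (int n * k)"
  by (induction n) (simp_all add: v_pow_def mult_single algebra_simps)

lemma u_pow_power: "u_pow k ^ n = u_pow (k * n)"
  by (simp add: u_pow_def monom_power)

lemma v_pow_0: "v_pow 0 = 1"
  by (simp add: v_pow_def)

lemma v1_pow_add: "v1_pow (k + l) = v1_pow k * v1_pow l"
  by (simp add: v1_pow_def const_def mult_single)

lemma v1_pow_0: "v1_pow 0 = 1"
  by (simp add: v1_pow_def const_def)

lemma geometric_sum_nat:
  fixes p :: nat
  assumes "p > 0"
  shows "int (p - 1) * int ((p ^ n - 1) div (p - 1)) = int (p ^ n - 1)"
proof -
  have "(p - 1) * (\<Sum>i<n. p ^ i) = p ^ n - 1"
  proof (induction n)
    case (Suc n)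
    have "(p - 1) * (\<Sum>i<Suc n. p ^ i) = (p ^ n - 1) + (p - 1) * p ^ n"
      using Suc by (simp add: distrib_left)
    also have "\<dots> = p ^ Suc n - 1"
      using assms by (simp add: algebra_simps Nat.diff_mult_distrib)
    finally show ?case .
  qed simp
  then have "(p - 1) dvd (p ^ n - 1)" by (metis dvd_triv_left)
  then show ?thesis by (metis dvd_mult_div_cancel of_nat_mult)
qed

lemma smult_of_nat_cancel:
  fixes f g :: "rat poly"
  assumes "m > 0"
  shows "smult (1 / of_nat m) f = g \<longleftrightarrow> f = of_nat m * g"
  using assms by (auto simp: of_nat_poly)

section \<open>The realization map and the images of the normalized generators\<close>

locale cooperations =
  fixes p :: nat
    and eta :: "BP_rat \<Rightarrow> BPBP_rat"
    and phi :: "E1t_rat set \<Rightarrow> KUku_rat"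
  assumes prime: "prime p"
    and right_unit: "right_unit p eta"
    and splitting_map: "splitting_map p eta phi"
begin

text \<open>
  The composite of \<open>E(1)\<^sub>*[t\<^sub>1, t\<^sub>2, \<dots>] \<rightarrow> E(1)\<^sub>*BP\<langle>1\<rangle>\<close> with \<open>\<phi>\<close>. It allows computing with representatives
  instead of cosets.
\<close>

definition realization :: "E1t_rat \<Rightarrow> KUku_rat" where
  "realization x = phi (E1BP1_class p eta x)"

abbreviation E1t_set :: "E1t_rat set" where
  "E1t_set \<equiv> coeffs_in (coeffs_in (Z_loc p))"

lemma p_pos: "p > 0"
  by (rule prime_gt_0_nat[OF prime])

lemma cring_E1t: "cring (subring_of_type E1t_set)"
  by (intro cring_coeffs_in cring_Z_loc prime)

lemma cring_BPBP: "cring (subring_of_type (BPBP p))"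
  unfolding BPBP_def by (intro cring_coeffs_in cring_BP prime)

lemma eta_hom: "eta \<in> ring_hom (subring_of_type (BP p)) (subring_of_type (BPBP p))"
  using right_unit by (simp add: right_unit_def)

lemma right_unit_gens_in_E1t: "{BPBP_to_E1t (eta (gen n)) | n. n \<ge> 2} \<subseteq> carrier (E1t p)"
  using ring_hom_closed[OF ring_hom_trans[OF eta_hom BPBP_to_E1t_hom[OF prime]]]
    gen_in_BP[OF prime] by (auto simp: subring_of_type_def)

lemma ideal_E1BP1: "ideal (E1BP1_ideal p eta) (E1t p)"
proof -
  interpret cring "E1t p" unfolding E1t_def by (rule cring_E1t)
  show ?thesis
    unfolding E1BP1_ideal_def by (rule genideal_ideal[OF right_unit_gens_in_E1t])
qed

lemma class_hom: "E1BP1_class p eta \<in> ring_hom (E1t p) (E1BP1 p eta)"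
  using ideal.rcos_ring_hom[OF ideal_E1BP1] by (simp add: E1BP1_class_def[abs_def] E1BP1_def)

lemma realization_hom: "realization \<in> ring_hom (subring_of_type E1t_set) (subring_of_type UNIV)"
  using ring_hom_trans[OF class_hom, of phi "subring_of_type UNIV"] splitting_map
  by (simp add: splitting_map_def comp_def realization_def[abs_def] E1t_def)

lemmas realization_simps =
  hom_mult[OF cring_E1t realization_hom] hom_one[OF cring_E1t realization_hom]
  hom_power[OF cring_E1t realization_hom]

lemma realization_right_unit:
  assumes "n \<ge> 2"
  shows "realization (BPBP_to_E1t (eta (gen n))) = 0"
proof -
  interpret I: ideal "E1BP1_ideal p eta" "E1t p" by (rule ideal_E1BP1)
  let ?x = "BPBP_to_E1t (eta (gen n))"
  have x: "?x \<in> E1BP1_ideal p eta"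
    using I.genideal_self[OF right_unit_gens_in_E1t] assms unfolding E1BP1_ideal_def by blast
  have "E1BP1_class p eta ?x = E1BP1_ideal p eta"
    "E1BP1_class p eta \<zero>\<^bsub>E1t p\<^esub> = E1BP1_ideal p eta"
    unfolding E1BP1_class_def using x by (auto intro!: I.a_rcos_const)
  then have "realization ?x = realization 0"
    by (simp add: realization_def E1t_def subring_of_type_def)
  then show ?thesis by (simp add: hom_zero[OF cring_E1t realization_hom])
qed

lemma v1_pow_in: "v1_pow k \<in> E1t_set"
  unfolding v1_pow_def const_def
  by (intro single_in_coeffs_in cring_coeffs_in cring_Z_loc prime subring_one)

lemma gen_in: "gen n \<in> E1t_set"
  by (intro gen_in_coeffs_in cring_coeffs_in cring_Z_loc prime)

text \<open>
  For negative exponents the value is forced, since a ring homomorphism preserves inverses.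
\<close>

lemma realization_v1_pow: "realization (v1_pow k) = v_pow (int (p - 1) * k)"
proof -
  have nat_pow: "realization (v1_pow (int n)) = v_pow (int (p - 1) * int n)" for n
  proof (induction n)
    case 0
    then show ?case by (simp add: v1_pow_0 v_pow_0 realization_simps)
  next
    case (Suc n)
    have "realization (v1_pow 1) = v_pow (int (p - 1))"
      using splitting_map by (simp add: splitting_map_def realization_def)
    moreover have "int (Suc n) = 1 + int n" by simp
    ultimately show ?case
      using Suc by (simp only: v1_pow_add realization_simps v1_pow_in distrib_left v_pow_add) simp
  qed
  show ?thesis
  proof (cases "k \<ge> 0")
    case True
    then show ?thesis using nat_pow[of "nat k"] by simp
  next
    case False
    then obtain n where k: "k = - int n" by (intro that[of "nat (- k)"]) simp
    let ?V = "v_pow (int (p - 1) * int n)" and ?V' = "v_pow (int (p - 1) * k)"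
    have "?V * ?V' = v_pow (int (p - 1) * int n + int (p - 1) * k)"
      by (simp only: v_pow_add)
    also have "\<dots> = 1" by (simp add: k v_pow_0)
    finally have inv: "?V * ?V' = 1" .
    have "realization (v1_pow (int n)) * realization (v1_pow k) = realization (v1_pow (int n + k))"
      by (simp only: v1_pow_add realization_simps v1_pow_in)
    also have "\<dots> = 1" by (simp add: k v1_pow_0 realization_simps)
    finally have "realization (v1_pow (int n)) * realization (v1_pow k) = 1" .
    then have "?V * realization (v1_pow k) = 1" by (simp only: nat_pow)
    then have "?V' * (?V * realization (v1_pow k)) = ?V'" by (simp only: mult_1_right)
    moreover have "?V' * (?V * realization (v1_pow k)) = (?V * ?V') * realization (v1_pow k)"
      by (simp only: mult_ac)
    ultimately show ?thesis by (simp only: inv mult_1_left)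
  qed
qed

lemma BPBP_realization_hom:
  "(\<lambda>x. realization (BPBP_to_E1t x)) \<in> ring_hom (subring_of_type (BPBP p)) (subring_of_type UNIV)"
  using ring_hom_trans[OF BPBP_to_E1t_hom[OF prime, unfolded E1t_def] realization_hom]
  by (simp add: comp_def)

lemma const_hom: "const \<in> ring_hom (subring_of_type (BP p)) (subring_of_type (BPBP p))"
  by (rule ring_hom_memI)
    (auto simp: subring_of_type_def const_def BPBP_def single_add mult_single
      intro!: single_in_coeffs_in cring_BP prime)

lemma realization_right_unit_int_log:
  "realization (BPBP_to_E1t (eta (int_log p n))) = u_pow (p ^ n - 1)"
proof -
  have "realization (BPBP_to_E1t (eta (gen 1))) = u_pow 1 ^ (p - 1)"
    using splitting_map by (simp add: splitting_map_def realization_def u_pow_power)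
  moreover have "(\<lambda>x. realization (BPBP_to_E1t (eta x))) \<in>
      ring_hom (subring_of_type (BP p)) (subring_of_type UNIV)"
    using ring_hom_trans[OF eta_hom BPBP_realization_hom] by (simp add: comp_def)
  ultimately have "realization (BPBP_to_E1t (eta (int_log p n))) = u_pow 1 ^ (p ^ n - 1)"
    by (intro hom_int_log[OF prime]) (simp_all only: realization_right_unit)
  then show ?thesis by (simp add: u_pow_power)
qed

lemma realization_left_unit_int_log:
  "realization (BPBP_to_E1t (const (int_log p n))) = v_pow (int (p ^ n - 1))"
proof -
  have "realization (BPBP_to_E1t (const (gen 1))) = v_pow 1 ^ (p - 1)"
    by (simp add: BPBP_to_E1t_const_gen realization_v1_pow v_pow_power del: One_nat_def)
  moreover have "realization (BPBP_to_E1t (const (gen n))) = 0" if "n \<ge> 2" for n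
    using that by (simp add: BPBP_to_E1t_const_gen hom_zero[OF cring_E1t realization_hom])
  moreover have "(\<lambda>x. realization (BPBP_to_E1t (const x))) \<in>
      ring_hom (subring_of_type (BP p)) (subring_of_type UNIV)"
    using ring_hom_trans[OF const_hom BPBP_realization_hom] by (simp add: comp_def)
  ultimately have "realization (BPBP_to_E1t (const (int_log p n))) = v_pow 1 ^ (p ^ n - 1)"
    by (intro hom_int_log[OF prime])
  then show ?thesis by (simp add: v_pow_power)
qed

text \<open>
  This is the right unit formula for \<open>p\<^sup>n \<lambda>\<^sub>n\<close>, evaluated in \<open>\<rat>[v, v\<^sup>-\<^sup>1, u]\<close> with the known images of
  the logarithm coefficients under both units.
\<close>

lemma realization_int_log_relation:
  "u_pow (p ^ n - 1) =
    (\<Sum>i\<le>n. of_nat (p ^ (n - i)) * (v_pow (int (p ^ i - 1)) * realization (gen (n - i)) ^ (p ^ i)))"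
proof -
  note hom = BPBP_realization_hom
  have gen_BPBP: "gen k \<in> BPBP p" for k
    unfolding BPBP_def by (intro gen_in_coeffs_in cring_BP prime)
  have const_BPBP: "const (int_log p k) \<in> BPBP p" for k
    unfolding BPBP_def const_def by (intro single_in_coeffs_in cring_BP prime int_log_in_BP)
  note in_BPBP = gen_BPBP const_BPBP subring_power[OF cring_BPBP] subring_mult[OF cring_BPBP]
    subring_of_nat[OF cring_BPBP]
  have "u_pow (p ^ n - 1) = realization (BPBP_to_E1t (eta (int_log p n)))"
    by (simp add: realization_right_unit_int_log)
  also have "\<dots> = realization (BPBP_to_E1t
      (\<Sum>i\<le>n. of_nat (p ^ (n - i)) * (const (int_log p i) * gen (n - i) ^ (p ^ i))))"
    by (simp add: right_unit_int_log[OF prime right_unit] mult.assoc)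
  also have "\<dots> = (\<Sum>i\<le>n. of_nat (p ^ (n - i)) *
      (v_pow (int (p ^ i - 1)) * realization (gen (n - i)) ^ (p ^ i)))"
    by (simp only: hom_sum[OF cring_BPBP hom] hom_mult[OF cring_BPBP hom]
        hom_of_nat[OF cring_BPBP hom] hom_power[OF cring_BPBP hom] in_BPBP
        realization_left_unit_int_log BPBP_to_E1t_gen)
  finally show ?thesis .
qed

text \<open>
  In \<open>KU\<^sub>*ku\<close> the normalizing power of \<open>v\<^sub>1 = v\<^bsup>p-1\<^esup>\<close> becomes a power of \<open>v\<close> whose exponent is an integer
  without quotient.
\<close>

lemma phi_normalized_t:
  "phi (normalized_t p eta n) = v_pow (- int (p ^ n - 1)) * realization (gen n)"
proof -
  have "phi (normalized_t p eta n) =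
      realization (v1_pow (- int ((p ^ n - 1) div (p - 1)))) * realization (gen n)"
    unfolding normalized_t_def realization_def[symmetric]
    by (simp add: realization_simps v1_pow_in gen_in)
  then show ?thesis
    by (simp only: realization_v1_pow mult_minus_right geometric_sum_nat[OF p_pos])
qed

text \<open>
  Division by \<open>v\<^bsup>p^n-1\<^esup>\<close> leaves no stray powers of \<open>v\<close>, because
  \<open>p\<^sup>n - 1 = (p\<^sup>i - 1) + p\<^sup>i (p\<^sup>n\<^sup>-\<^sup>i - 1)\<close>.
\<close>

lemma normalized_t_relation:
  "subst_w (w ^ (p ^ n - 1)) =
    (\<Sum>i\<le>n. of_nat (p ^ (n - i)) * phi (normalized_t p eta (n - i)) ^ (p ^ i))"
proof -
  have summand: "v_pow (- int (p ^ n - 1)) *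
      (of_nat (p ^ (n - i)) * (v_pow (int (p ^ i - 1)) * realization (gen (n - i)) ^ (p ^ i))) =
      of_nat (p ^ (n - i)) * phi (normalized_t p eta (n - i)) ^ (p ^ i)" if "i \<le> n" for i
  proof -
    have "int (p ^ n - 1) = int (p ^ i - 1) + int (p ^ i) * int (p ^ (n - i) - 1)"
      using that p_pos by (simp add: of_nat_diff right_diff_distrib flip: power_add)
    then have "v_pow (- int (p ^ n - 1)) * v_pow (int (p ^ i - 1)) =
        v_pow (- int (p ^ (n - i) - 1)) ^ (p ^ i)"
      by (simp add: v_pow_power flip: v_pow_add)
    then show ?thesis
      by (simp add: phi_normalized_t power_mult_distrib mult_ac)
  qed
  have "subst_w (w ^ (p ^ n - 1)) = v_pow (- int (p ^ n - 1)) *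
      (\<Sum>i\<le>n. of_nat (p ^ (n - i)) * (v_pow (int (p ^ i - 1)) * realization (gen (n - i)) ^ (p ^ i)))"
    by (simp only: subst_w_w_power flip: realization_int_log_relation)
  also have "\<dots> = (\<Sum>i\<le>n. v_pow (- int (p ^ n - 1)) *
      (of_nat (p ^ (n - i)) * (v_pow (int (p ^ i - 1)) * realization (gen (n - i)) ^ (p ^ i))))"
    by (rule sum_distrib_left)
  also have "\<dots> = (\<Sum>i\<le>n. of_nat (p ^ (n - i)) * phi (normalized_t p eta (n - i)) ^ (p ^ i))"
    by (rule sum.cong[OF refl], rule summand) (simp only: atMost_iff)
  finally show ?thesis .
qed

text \<open>
  The terms \<open>i = 0\<close> and \<open>i = n\<close> of the relation are split off. Stated for arbitrary polynomials \<open>F k\<close>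
  that represent the earlier images, it can be used inside the induction that shows such polynomials
  to exist.
\<close>

lemma normalized_t_recursion:
  assumes "n \<ge> 1" and F: "\<And>k. k \<in> {1..<n} \<Longrightarrow> subst_w (F k) = phi (normalized_t p eta k)"
  shows "subst_w (w ^ (p ^ n - 1) - 1 - (\<Sum>j = 1..n - 1. of_nat (p ^ (n - j)) * F (n - j) ^ (p ^ j))) =
    of_nat (p ^ n) * phi (normalized_t p eta n)"
proof -
  let ?t = "\<lambda>i. of_nat (p ^ (n - i)) * phi (normalized_t p eta (n - i)) ^ (p ^ i)"
  let ?S = "\<Sum>j = 1..n - 1. of_nat (p ^ (n - j)) * F (n - j) ^ (p ^ j)"
  \<comment> \<open>By the convention \<open>t\<^sub>0 = 1\<close>, the summand with index \<open>n\<close> is 1.\<close>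
  have t0: "phi (normalized_t p eta 0) = 1"
    using hom_one[OF cring_E1t realization_hom] by (simp add: phi_normalized_t v_pow_0 gen_def)
  have S: "subst_w ?S = sum ?t {1..n - 1}"
    unfolding subst_w_sum
    by (rule sum.cong)
      (use F in \<open>auto simp: subst_w_mult subst_w_power subst_w_of_nat simp del: of_nat_power\<close>)
  have split: "{..n} = insert 0 (insert n {1..n - 1})" and "n \<notin> {1..n - 1}"
    using assms by auto
  then have "sum ?t {..n} = ?t 0 + (?t n + sum ?t {1..n - 1})"
    using assms by (simp only: split) (subst sum.insert; simp)+
  then have "subst_w (w ^ (p ^ n - 1)) = of_nat (p ^ n) * phi (normalized_t p eta n) + 1 + subst_w ?S"
    unfolding normalized_t_relation S by (simp add: t0)
  then show ?thesis
    by (simp only: subst_w_diff subst_w_one) (simp add: algebra_simps)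
qed

text \<open>
  The definite description in the definition of the polynomials is justified by strong induction: the
  recursion supplies a polynomial that represents the image, and injectivity of the substitution makes
  it the only one. Division by \<open>p\<^sup>n\<close> is legitimate since \<open>\<rat>[v, v\<^sup>-\<^sup>1, u]\<close> is torsion-free.
\<close>

lemma subst_w_phi_poly:
  "n \<ge> 1 \<Longrightarrow> subst_w (phi_poly p eta phi n) = phi (normalized_t p eta n)"
proof (induction n rule: less_induct)
  case (less n)
  define f where "f = w ^ (p ^ n - 1) - 1 -
    (\<Sum>j = 1..n - 1. of_nat (p ^ (n - j)) * phi_poly p eta phi (n - j) ^ (p ^ j))"
  define g where "g = smult (1 / of_nat (p ^ n)) f"
  have "p ^ n > 0" using p_pos by simp
  then have f_eq: "f = of_nat (p ^ n) * g"
    by (rule smult_of_nat_cancel[THEN iffD1]) (simp only: g_def)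
  have "of_nat (p ^ n) * subst_w g = subst_w f"
    by (simp only: f_eq subst_w_mult subst_w_of_nat)
  also have "\<dots> = of_nat (p ^ n) * phi (normalized_t p eta n)"
    unfolding f_def using less.prems by (intro normalized_t_recursion less.IH) simp_all
  finally have g: "subst_w g = phi (normalized_t p eta n)"
    using \<open>p ^ n > 0\<close> by (metis mult_cancel_left of_nat_eq_0_iff less_numeral_extra(3))
  then have "phi_poly p eta phi n = g"
    unfolding phi_poly_def by (intro the_equality) (simp_all only: flip: subst_w_inject)
  with g show ?case by simp
qed

lemma phi_poly_rec:
  assumes "n \<ge> 1"
  shows "phi_poly p eta phi n = smult (1 / of_nat (p ^ n)) (w ^ (p ^ n - 1) - 1 -
    (\<Sum>j = 1..n - 1. of_nat (p ^ (n - j)) * phi_poly p eta phi (n - j) ^ (p ^ j)))"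
proof (rule sym, subst smult_of_nat_cancel)
  show "w ^ (p ^ n - 1) - 1 -
      (\<Sum>j = 1..n - 1. of_nat (p ^ (n - j)) * phi_poly p eta phi (n - j) ^ (p ^ j)) =
    of_nat (p ^ n) * phi_poly p eta phi n"
    using assms normalized_t_recursion[of n "phi_poly p eta phi"]
    by (intro subst_w_inject[THEN iffD1])
      (auto simp: subst_w_mult subst_w_of_nat subst_w_phi_poly simp del: of_nat_power)
qed (use p_pos in simp)

text \<open>
  The image of \<open>\<phi>\<close> is the summand of \<open>KU\<^sub>*ku\<close> with \<open>i = j = 0\<close>, present because \<open>p - 1 \<ge> 1\<close>.
\<close>

lemma phi_in_KUku:
  assumes "x \<in> carrier (E1BP1 p eta)"
  shows "phi x \<in> KUku p eta phi"
proof -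
  define X where "X = (\<lambda>(i :: nat) (j :: nat). if i = 0 \<and> j = 0 then x else E1BP1_class p eta 0)"
  have zero: "E1BP1_class p eta 0 \<in> carrier (E1BP1 p eta)"
    using ring_hom_closed[OF class_hom, of 0] subring_zero[OF cring_E1t]
    by (simp add: E1t_def subring_of_type_def)
  have phi_X: "phi (X i j) = (if i = 0 \<and> j = 0 then phi x else 0)" for i j
    using hom_zero[OF cring_E1t realization_hom] by (simp add: X_def realization_def)
  have "p - 1 > 0" using prime_gt_1_nat[OF prime] by simp
  then have "(\<Sum>i<p - 1. \<Sum>j<p - 1. v_pow (int i) * u_pow j * phi (X i j)) =
      (\<Sum>i<p - 1. \<Sum>j<p - 1. if j = 0 then if i = 0 then phi x else 0 else 0)"
    by (intro sum.cong refl) (simp add: phi_X v_pow_0 u_pow_def)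
  also have "\<dots> = phi x" using \<open>p - 1 > 0\<close> by (simp add: sum.delta)
  finally show ?thesis
    unfolding KUku_def using assms zero by (intro CollectI exI[of _ X]) (auto simp: X_def)
qed

lemma normalized_t_in: "normalized_t p eta n \<in> carrier (E1BP1 p eta)"
  unfolding normalized_t_def
  by (rule ring_hom_closed[OF class_hom])
    (simp add: E1t_def subring_of_type_def subring_mult[OF cring_E1t] v1_pow_in gen_in)

end

theorem theorem2:
  fixes p :: nat
    and eta :: "BP_rat \<Rightarrow> BPBP_rat"
    and phi :: "E1t_rat set \<Rightarrow> KUku_rat"
  assumes "prime p"
    and "right_unit p eta"
    and "splitting_map p eta phi"
  shows "(\<forall>n\<ge>1. phi_poly p eta phi n \<in> semistable_numerical p eta phi \<and>
            subst_w (phi_poly p eta phi n) = phi (normalized_t p eta n)) \<and>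
         phi_poly p eta phi 1 = smult (1 / of_nat p) (w ^ (p - 1) - 1) \<and>
         (\<forall>n\<ge>2. phi_poly p eta phi n =
            smult (1 / of_nat (p ^ n))
              (w ^ (p ^ n - 1) - 1 -
                (\<Sum>j = 1..n - 1. of_nat (p ^ (n - j)) * phi_poly p eta phi (n - j) ^ (p ^ j))))"
proof -
  interpret cooperations p eta phi by (rule cooperations.intro) (rule assms)+
  show ?thesis
  proof (intro conjI allI impI)
    fix n :: nat assume "n \<ge> 1"
    then show "subst_w (phi_poly p eta phi n) = phi (normalized_t p eta n)"
      by (rule subst_w_phi_poly)
    then show "phi_poly p eta phi n \<in> semistable_numerical p eta phi"
      by (simp add: semistable_numerical_def phi_in_KUku normalized_t_in)
  next
    show "phi_poly p eta phi 1 = smult (1 / of_nat p) (w ^ (p - 1) - 1)"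
      using phi_poly_rec[of 1] by simp
  next
    fix n :: nat assume "n \<ge> 2"
    then show "phi_poly p eta phi n = smult (1 / of_nat (p ^ n)) (w ^ (p ^ n - 1) - 1 -
        (\<Sum>j = 1..n - 1. of_nat (p ^ (n - j)) * phi_poly p eta phi (n - j) ^ (p ^ j)))"
      by (intro phi_poly_rec) simp
  qed
qed

end
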